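(* Let $a$ and $b$ be non-negative integers with $m:=a+b+1\ge 2$, and let $n\ge 2$ be an integer. Put $\zeta_n:=\exp(2\pi\sqrt{-1}/n)$. For positive integers $s_1,\dots,s_m$ define $$\mathfrak Z_n(\zeta_n;;s_1,\dots,s_m):=\sum_{1\le i_1<i_2<\dots<i_m\le n-1}\frac{1}{(1-\zeta_n^{i_1})^{s_1}(1-\zeta_n^{i_2})^{s_2}\cdots(1-\zeta_n^{i_m})^{s_m}}$$ (an empty sum being $0$). Then $$\mathfrak Z_n(\zeta_n;;\underbrace{1,\dots,1}_a,2,\underbrace{1,\dots,1}_b)+\mathfrak Z_n(\zeta_n;;\underbrace{1,\dots,1}_b,2,\underbrace{1,\dots,1}_a)=-\frac{m!\,(n-2m-3)}{(m+2)!}\binom{n-1}{m},$$ where in each argument list there are $m$ entries in total: $a$ (resp. $b$) ones, then a $2$, then $b$ (resp. $a$) ones.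
   Context: $\binom{n-1}{m}$ is the usual binomial coefficient (equal to $0$ when $m>n-1$). *)

theory Defs
  imports Complex_Main
begin

text \<open>Index tuples \<open>i\<^sub>1 < \<dots> < i\<^sub>m\<close> are represented as strictly increasing lists.\<close>

definition index_tuples :: "nat \<Rightarrow> nat \<Rightarrow> nat list set" where
  "index_tuples n m = {is. length is = m \<and> set is \<subseteq> {1..n - 1} \<and> sorted_wrt (<) is}"

lemma finite_index_tuples: "finite (index_tuples n m)"
proof (rule finite_subset)
  show "index_tuples n m \<subseteq> {is. set is \<subseteq> {1..n - 1} \<and> length is = m}"
    by (auto simp: index_tuples_def)
qed (rule finite_lists_length_eq, simp)

definition cyc_sum :: "nat \<Rightarrow> complex \<Rightarrow> nat list \<Rightarrow> complex" where
  "cyc_sum n q s =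
     (\<Sum>is\<in>index_tuples n (length s). 1 / (\<Prod>k<length s. (1 - q ^ (is ! k)) ^ (s ! k)))"

definition root_of_unity :: "nat \<Rightarrow> complex" where
  "root_of_unity n = exp (2 * of_real pi * \<i> / of_nat n)"

end

theory Submission
  imports Defs "HOL-Computational_Algebra.Polynomial"
begin

text \<open>
  Write \<open>q\<close> for the root of unity and \<open>x\<^sub>i = 1 / (1 - q ^ i)\<close>. The generating function of the sums with
  \<open>a\<close> ones before and \<open>b\<close> ones after the \<open>2\<close> is
  \<open>F(u, v) = \<Sum>\<^sub>i x\<^sub>i\<^sup>2 (\<Prod>\<^sub>j\<^sub><\<^sub>i (1 + u x\<^sub>j)) (\<Prod>\<^sub>j\<^sub>>\<^sub>i (1 + v x\<^sub>j))\<close>, a polynomial of degree at most \<open>n - 2\<close> in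
  each variable, so it suffices to evaluate \<open>F(u, v) + F(v, u)\<close> on the grid \<open>u = q ^ s - 1\<close>,
  \<open>v = q ^ t - 1\<close> with \<open>1 \<le> s, t < n\<close>. A first-order \<open>q\<close>-difference equation in the second variable
  yields \<open>F = 0\<close> for \<open>s < t\<close>, \<open>F = - q ^ (- s) x\<^sub>s\<^sup>2\<close> for \<open>s = t\<close> and \<open>F = - x\<^sub>s x\<^sub>t\<close> for \<open>s > t\<close>. These are
  also the values of \<open>(H(u) - H(v)) / (u - v)\<close> (of \<open>H'(u)\<close> on the diagonal) for the polynomial
  \<open>H\<close> of degree below \<open>n\<close> with \<open>n u\<^sup>2 H(u) = n u - (1 - u) ((1 + u) ^ n - 1)\<close>, whose coefficients are the
  claimed right-hand sides.
\<close>

subsection \<open>Elementary symmetric sums\<close>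

definition esym :: "('a \<Rightarrow> 'b::comm_semiring_1) \<Rightarrow> nat \<Rightarrow> 'a set \<Rightarrow> 'b" where
  "esym x k S = (\<Sum>X | X \<subseteq> S \<and> card X = k. \<Prod>j\<in>X. x j)"

text \<open>Expand the product over the subsets of \<open>S\<close> and group them by cardinality;
  \<open>card S < N\<close> ensures that the truncation loses no subset.\<close>

lemma esym_generating_function:
  assumes "finite S" "card S < N"
  shows "(\<Sum>k<N. esym x k S * u ^ k) = (\<Prod>j\<in>S. 1 + u * x j)"
proof -
  have card: "card X < N" if "X \<subseteq> S" for X
    using card_mono[OF assms(1) that] assms(2) by simp
  have "(\<Prod>j\<in>S. 1 + u * x j) = (\<Prod>j\<in>S. u * x j + 1)"
    by (simp add: add.commute)
  also have "\<dots> = (\<Sum>X\<in>Pow S. \<Prod>j\<in>X. u * x j)"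
    by (subst prod_add[OF assms(1)]) simp
  also have "\<dots> = (\<Sum>k<N. \<Sum>X | X \<in> Pow S \<and> card X = k. \<Prod>j\<in>X. u * x j)"
    by (rule sum.group[symmetric]) (use assms(1) card in auto)
  also have "\<dots> = (\<Sum>k<N. esym x k S * u ^ k)"
    unfolding esym_def sum_distrib_right
    by (intro sum.cong) (auto simp: prod.distrib mult.commute)
  finally show ?thesis ..
qed

section \<open>From increasing index tuples to elementary symmetric sums\<close>

lemma prod_list_map2_replicate_1:
  fixes f :: "'a \<Rightarrow> 'b::comm_monoid_mult"
  assumes "length xs = a"
  shows "prod_list (map2 (\<lambda>i e. f i ^ e) xs (replicate a 1)) = prod_list (map f xs)"
  using assms by (induction xs arbitrary: a) auto

lemma prod_nth_powers_one_two:
  fixes f :: "nat \<Rightarrow> complex"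
  assumes "length xs = a" "length ys = b" "sorted_wrt (<) xs" "sorted_wrt (<) ys"
  shows "(\<Prod>k<a + b + 1. f ((xs @ i # ys) ! k) ^ ((replicate a 1 @ [2] @ replicate b 1) ! k))
           = (\<Prod>j\<in>set xs. f j) * f i ^ 2 * (\<Prod>j\<in>set ys. f j)"
proof -
  let ?is = "xs @ i # ys" and ?s = "replicate a 1 @ [2] @ replicate b (1::nat)"
  have "(\<Prod>k<a + b + 1. f (?is ! k) ^ (?s ! k)) = prod_list (map2 (\<lambda>i e. f i ^ e) ?is ?s)"
    unfolding prod.list_conv_set_nth atLeast0LessThan
    by (rule prod.cong) (use assms(1,2) in \<open>simp_all del: zip_append append_Cons append.simps replicate_append_same\<close>)
  also have "\<dots> = prod_list (map f xs) * f i ^ 2 * prod_list (map f ys)"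
    using prod_list_map2_replicate_1[OF assms(1), of f] prod_list_map2_replicate_1[OF assms(2), of f]
      assms(1,2)
    by (simp add: mult.assoc)
  also have "\<dots> = (\<Prod>j\<in>set xs. f j) * f i ^ 2 * (\<Prod>j\<in>set ys. f j)"
    using assms(3,4) by (simp add: prod.distinct_set_conv_list strict_sorted_iff)
  finally show ?thesis .
qed

text \<open>A strictly increasing list is determined by its set of entries. Cutting at position
  \<open>a\<close> is therefore a bijection onto triples \<open>(i, X, Y)\<close> with
  \<open>X\<close> below \<open>i\<close> and \<open>Y\<close> above, inverted by sorting both
  sets.\<close>

lemma index_tuples_split_sum:
  fixes h :: "nat set \<Rightarrow> nat \<Rightarrow> nat set \<Rightarrow> 'b::comm_monoid_add"
  shows "(\<Sum>is\<in>index_tuples n (a + b + 1). h (set (take a is)) (is ! a) (set (drop (Suc a) is)))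
    = (\<Sum>i\<in>{1..<n}. \<Sum>X | X \<subseteq> {1..<i} \<and> card X = a. \<Sum>Y | Y \<subseteq> {i<..<n} \<and> card Y = b. h X i Y)"
proof -
  let ?R = "SIGMA i:{1..<n}. SIGMA X:{X. X \<subseteq> {1..<i} \<and> card X = a}. {Y. Y \<subseteq> {i<..<n} \<and> card Y = b}"
  have "(\<Sum>is\<in>index_tuples n (a + b + 1). h (set (take a is)) (is ! a) (set (drop (Suc a) is)))
    = (\<Sum>(i, X, Y)\<in>?R. h X i Y)"
  proof (rule sum.reindex_bij_witness[where
        j = "\<lambda>is. (is ! a, set (take a is), set (drop (Suc a) is))" and
        i = "\<lambda>(i, X, Y). sorted_list_of_set X @ i # sorted_list_of_set Y"], goal_cases)
    case (1 "is")
    then have len: "length is = a + b + 1" and s: "sorted_wrt (<) is" by (auto simp: index_tuples_def)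
    have split: "is = take a is @ is ! a # drop (Suc a) is" using len by (simp add: id_take_nth_drop)
    have "sorted_wrt (<) (take a is)" "sorted_wrt (<) (drop (Suc a) is)"
      using s by (simp_all add: sorted_wrt_take sorted_wrt_drop)
    then show ?case using split
      by (simp add: sorted_list_of_set.idem_if_sorted_distinct strict_sorted_iff)
  next
    case (2 "is")
    then have len: "length is = a + b + 1" and s: "sorted_wrt (<) is" and sub: "set is \<subseteq> {1..n - 1}"
      by (auto simp: index_tuples_def)
    have split: "is = take a is @ is ! a # drop (Suc a) is" using len by (simp add: id_take_nth_drop)
    define xs i ys where d: "xs = take a is" "i = is ! a" "ys = drop (Suc a) is"
    have eq: "is = xs @ i # ys" using split d by simp
    have l: "length xs = a" "length ys = b" using len d by auto
    have s': "sorted_wrt (<) (xs @ i # ys)" and sub': "set (xs @ i # ys) \<subseteq> {1..n - 1}"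
      using s sub eq by auto
    have "distinct xs" "distinct ys" using s' by (auto simp: sorted_wrt_append strict_sorted_iff)
    then have "card (set xs) = a" "card (set ys) = b" using l by (auto simp: distinct_card)
    moreover have "i \<in> {1..<n}" using sub' by auto
    moreover have "set xs \<subseteq> {1..<i}" "set ys \<subseteq> {i<..<n}"
      using s' sub' by (fastforce simp: sorted_wrt_append)+
    ultimately show ?case by (simp add: d)
  next
    case (3 t)
    obtain i X Y where t: "t = (i, X, Y)" by (cases t) auto
    have R: "X \<subseteq> {1..<i}" "card X = a" "Y \<subseteq> {i<..<n}" "card Y = b" using 3 t by auto
    then have "finite X" "finite Y" by (auto intro: finite_subset)
    with R t show ?case by (simp add: nth_append)
  next
    case (4 t)
    obtain i X Y where t: "t = (i, X, Y)" by (cases t) auto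
    have R: "i \<in> {1..<n}" "X \<subseteq> {1..<i}" "card X = a" "Y \<subseteq> {i<..<n}" "card Y = b" using 4 t by auto
    then have "finite X" "finite Y" by (auto intro: finite_subset)
    with R t show ?case by (fastforce simp: index_tuples_def sorted_wrt_append)
  next
    case (5 "is")
    then show ?case by simp
  qed
  also have "\<dots> = (\<Sum>i\<in>{1..<n}. \<Sum>X | X \<subseteq> {1..<i} \<and> card X = a.
      \<Sum>Y | Y \<subseteq> {i<..<n} \<and> card Y = b. h X i Y)"
    by (simp add: sum.Sigma finite_subset[OF _ finite_Collect_subsets] del: mem_Collect_eq)
  finally show ?thesis .
qed

text \<open>Once the index \<open>i\<close> carrying the exponent 2 is fixed, the indices below and
  above it are chosen independently, so the sum factors.\<close>

lemma cyc_sum_one_two_one: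
  "cyc_sum n q (replicate a 1 @ [2] @ replicate b 1)
     = (\<Sum>i\<in>{1..<n}. (1 / (1 - q ^ i)) ^ 2 * esym (\<lambda>j. 1 / (1 - q ^ j)) a {1..<i}
                                            * esym (\<lambda>j. 1 / (1 - q ^ j)) b {i<..<n})"
proof -
  let ?x = "\<lambda>j. 1 / (1 - q ^ j)" and ?s = "replicate a 1 @ [2] @ replicate b (1::nat)"
  have "cyc_sum n q ?s = (\<Sum>is\<in>index_tuples n (a + b + 1).
      (\<Prod>j\<in>set (take a is). ?x j) * ?x (is ! a) ^ 2 * (\<Prod>j\<in>set (drop (Suc a) is). ?x j))"
    unfolding cyc_sum_def
  proof (rule sum.cong)
    fix "is" assume "is \<in> index_tuples n (a + b + 1)"
    then have len: "length is = a + b + 1" and s: "sorted_wrt (<) is" by (auto simp: index_tuples_def)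
    have split: "is = take a is @ is ! a # drop (Suc a) is" using len by (simp add: id_take_nth_drop)
    have "(\<Prod>k<length ?s. (1 - q ^ (is ! k)) ^ (?s ! k)) =
       (\<Prod>j\<in>set (take a is). 1 - q ^ j) * (1 - q ^ (is ! a)) ^ 2 * (\<Prod>j\<in>set (drop (Suc a) is). 1 - q ^ j)"
      using prod_nth_powers_one_two[of "take a is" a "drop (Suc a) is" b "\<lambda>j. 1 - q ^ j" "is ! a"]
        s len split by (simp add: sorted_wrt_take sorted_wrt_drop)
    then show "1 / (\<Prod>k<length ?s. (1 - q ^ (is ! k)) ^ (?s ! k)) =
       (\<Prod>j\<in>set (take a is). ?x j) * ?x (is ! a) ^ 2 * (\<Prod>j\<in>set (drop (Suc a) is). ?x j)"
      by (simp add: prod_dividef power_divide)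
  qed simp
  also have "\<dots> = (\<Sum>i\<in>{1..<n}. \<Sum>X | X \<subseteq> {1..<i} \<and> card X = a. \<Sum>Y | Y \<subseteq> {i<..<n} \<and> card Y = b.
      (\<Prod>j\<in>X. ?x j) * ?x i ^ 2 * (\<Prod>j\<in>Y. ?x j))"
    by (rule index_tuples_split_sum)
  also have "\<dots> = (\<Sum>i\<in>{1..<n}. ?x i ^ 2 * esym ?x a {1..<i} * esym ?x b {i<..<n})"
    unfolding esym_def
    by (intro sum.cong) (simp_all add: sum_distrib_left sum_distrib_right mult_ac)
  finally show ?thesis .
qed

lemma cyc_sum_generating_function:
  assumes "n \<ge> 2"
  shows "(\<Sum>a<n - 1. \<Sum>b<n - 1. cyc_sum n q (replicate a 1 @ [2] @ replicate b 1) * u ^ a * v ^ b)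
     = (\<Sum>i\<in>{1..<n}. (1 / (1 - q ^ i)) ^ 2 * (\<Prod>j\<in>{1..<i}. 1 + u * (1 / (1 - q ^ j)))
                                            * (\<Prod>j\<in>{i<..<n}. 1 + v * (1 / (1 - q ^ j))))"
proof -
  let ?x = "\<lambda>j. 1 / (1 - q ^ j)"
  let ?t = "\<lambda>i a b. ?x i ^ 2 * (esym ?x a {1..<i} * u ^ a) * (esym ?x b {i<..<n} * v ^ b)"
  have "(\<Sum>a<n - 1. \<Sum>b<n - 1. cyc_sum n q (replicate a 1 @ [2] @ replicate b 1) * u ^ a * v ^ b)
     = (\<Sum>a<n - 1. \<Sum>b<n - 1. \<Sum>i\<in>{1..<n}. ?t i a b)"
    unfolding cyc_sum_one_two_one sum_distrib_right by (simp only: mult_ac)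
  also have "\<dots> = (\<Sum>a<n - 1. \<Sum>i\<in>{1..<n}. \<Sum>b<n - 1. ?t i a b)"
    by (rule sum.cong[OF refl], rule sum.swap)
  also have "\<dots> = (\<Sum>i\<in>{1..<n}. \<Sum>a<n - 1. \<Sum>b<n - 1. ?t i a b)"
    by (rule sum.swap)
  also have "\<dots> = (\<Sum>i\<in>{1..<n}. ?x i ^ 2 * (\<Sum>a<n - 1. esym ?x a {1..<i} * u ^ a)
                                         * (\<Sum>b<n - 1. esym ?x b {i<..<n} * v ^ b))"
    by (simp only: sum_distrib_left sum_distrib_right)
      (rule sum.cong[OF refl], rule sum.swap)
  \<comment> \<open>Both index ranges have at most \<open>n - 2\<close> elements, so exponents below
    \<open>n - 1\<close> capture the full products.\<close>
  also have "\<dots> = (\<Sum>i\<in>{1..<n}. ?x i ^ 2 * (\<Prod>j\<in>{1..<i}. 1 + u * ?x j) * (\<Prod>j\<in>{i<..<n}. 1 + v * ?x j))"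
    by (rule sum.cong) (use assms in \<open>auto simp: esym_generating_function\<close>)
  finally show ?thesis .
qed

subsection \<open>Evaluation at roots of unity\<close>

locale primitive_root_of_unity =
  fixes n :: nat and q :: complex
  assumes n_ge_2: "n \<ge> 2"
    and power_n: "q ^ n = 1"
    and inj_powers: "inj_on (\<lambda>k. q ^ k) {..<n}"
begin

lemma power_eq_iff: "i < n \<Longrightarrow> j < n \<Longrightarrow> q ^ i = q ^ j \<longleftrightarrow> i = j"
  using inj_powers by (auto simp: inj_on_def)

lemma power_neq_1: "0 < i \<Longrightarrow> i < n \<Longrightarrow> q ^ i \<noteq> 1"
  using power_eq_iff[of i 0] by auto

lemma q_nonzero: "q \<noteq> 0"
  using power_n n_ge_2 by (auto simp: power_0_left)

lemma power_power_n: "(q ^ i) ^ n = 1"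
  by (metis power_commutes power_mult power_n power_one mult.commute)

text \<open>This is (X^n - 1) / (X - 1), which is in general not the n-th cyclotomic
  polynomial.\<close>

definition cyclo :: "complex poly" where
  "cyclo = (\<Prod>j\<in>{1..<n}. [:- (q ^ j), 1:])"

text \<open>Both sides are monic of degree \<open>n\<close> and vanish at the \<open>n\<close>
  distinct powers of \<open>q\<close>.\<close>

lemma cyclo_times_X_minus_1: "[:-1, 1:] * cyclo = monom 1 n - 1"
proof -
  have deg: "degree cyclo = n - 1"
    unfolding cyclo_def by (subst degree_prod_sum_eq) auto
  have lead: "lead_coeff cyclo = 1"
    unfolding cyclo_def by (simp add: lead_coeff_prod)
  have cyclo0: "cyclo \<noteq> 0" using lead by auto
  show ?thesis
  proof (rule poly_eqI_degree_lead_coeff[where n = n and A = "(\<lambda>k. q ^ k) ` {..<n}"])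
    show "coeff ([:-1, 1:] * cyclo) n = coeff (monom 1 n - 1) n"
    proof -
      have "lead_coeff ([:-1, 1:] * cyclo) = 1" using lead by (simp only: lead_coeff_mult) simp
      moreover have "degree ([:-1, 1:] * cyclo) = n"
        using deg cyclo0 n_ge_2 by (subst degree_mult_eq) auto
      ultimately have "coeff ([:-1, 1:] * cyclo) n = 1" by metis
      then show ?thesis using n_ge_2 by simp
    qed
    show "n \<le> card ((\<lambda>k. q ^ k) ` {..<n})" using card_image[OF inj_powers] by simp
    show "degree ([:-1, 1:] * cyclo) \<le> n"
      using deg cyclo0 n_ge_2 by (subst degree_mult_eq) auto
    show "degree (monom 1 n - 1 :: complex poly) \<le> n"
      by (intro degree_diff_le) (simp_all add: degree_monom_le)
    fix z assume "z \<in> (\<lambda>k. q ^ k) ` {..<n}"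
    then obtain k where k: "k < n" "z = q ^ k" by auto
    have "poly ([:-1, 1:] * cyclo) z = 0"
    proof (cases "k = 0")
      case False
      with k have "poly cyclo z = 0" by (auto simp: cyclo_def poly_prod)
      then show ?thesis by simp
    qed (use k in simp)
    then show "poly ([:-1, 1:] * cyclo) z = poly (monom 1 n - 1) z"
      using k power_power_n by (simp add: poly_monom)
  qed
qed

lemma poly_cyclo: "poly cyclo z = (\<Sum>k<n. z ^ k)"
proof -
  have "[:-1, 1:] * cyclo = [:-1, 1:] * (\<Sum>k<n. monom 1 k)"
  proof (subst poly_eq_poly_eq_iff[symmetric], rule ext)
    fix x show "poly ([:-1, 1:] * cyclo) x = poly ([:-1, 1:] * (\<Sum>k<n. monom 1 k)) x"
      unfolding cyclo_times_X_minus_1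
      using power_diff_1_eq[of x n] by (simp add: poly_monom poly_sum algebra_simps)
  qed
  then have "cyclo = (\<Sum>k<n. monom 1 k)" by (subst (asm) mult_left_cancel) auto
  then show ?thesis by (simp add: poly_sum poly_monom)
qed

lemma prod_one_minus_powers: "(\<Prod>j\<in>{1..<n}. 1 - q ^ j) = of_nat n"
  using poly_cyclo[of 1] by (simp add: cyclo_def poly_prod)

text \<open>Put A = 1 + u and B = 1 + v. Since 1 + u x_j = (A - q^j) x_j and the product of all 1 -
  q^j is n, the i-th summand of F(u, v) equals \<open>wt A B i / (1 - q ^ i)\<close> divided by
  n.\<close>

definition wt :: "complex \<Rightarrow> complex \<Rightarrow> nat \<Rightarrow> complex" where
  "wt A B i = (\<Prod>j\<in>{1..<i}. A - q ^ j) * (\<Prod>j\<in>{i<..<n}. B - q ^ j)"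

text \<open>Writing A - B = (A - q^i) - (B - q^i) makes each term a difference of consecutive mixed
  products \<open>?W\<close>, which pass from all factors in B to all factors in A.\<close>

lemma sum_wt_telescope:
  "(A - B) * (\<Sum>i\<in>{1..<n}. wt A B i) = poly cyclo A - poly cyclo B"
proof -
  let ?W = "\<lambda>i. (\<Prod>j\<in>{1..<i}. A - q ^ j) * (\<Prod>j\<in>{i..<n}. B - q ^ j)"
  have step: "(A - B) * wt A B i = ?W (Suc i) - ?W i" if "i \<in> {1..<n}" for i
  proof -
    have "{1..<Suc i} = insert i {1..<i}" "{i..<n} = insert i {i<..<n}" "{Suc i..<n} = {i<..<n}"
      using that by auto
    then show ?thesis by (simp add: wt_def algebra_simps)
  qed
  have "(A - B) * (\<Sum>i\<in>{1..<n}. wt A B i) = (\<Sum>i\<in>{1..<n}. ?W (Suc i) - ?W i)"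
    using step by (simp only: sum_distrib_left cong: sum.cong)
  also have "\<dots> = ?W n - ?W 1"
    by (rule sum_Suc_diff') (use n_ge_2 in simp)
  finally show ?thesis by (simp add: cyclo_def poly_prod)
qed

lemma sum_wt_diagonal: "(\<Sum>i\<in>{1..<n}. wt A A i) = poly (pderiv cyclo) A"
proof -
  have "wt A A i = poly (prod (\<lambda>j. [:- (q ^ j), 1:]) ({1..<n} - {i}) * pderiv [:- (q ^ i), 1:]) A"
    if "i \<in> {1..<n}" for i
  proof -
    have "{1..<n} - {i} = {1..<i} \<union> {i<..<n}" "{1..<i} \<inter> {i<..<n} = {}"
      using that by auto
    then show ?thesis by (simp add: wt_def poly_prod pderiv_pCons prod.union_disjoint)
  qed
  then show ?thesis
    unfolding cyclo_def pderiv_prod poly_sum by (rule sum.cong[OF refl])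
qed

text \<open>For distinct \<open>s\<close> and \<open>t\<close> the telescoped values of
  \<open>cyclo\<close> both vanish. On the diagonal the sum is the derivative of
  \<open>cyclo\<close>, found by differentiating (X - 1) \<open>cyclo\<close> = X^n - 1 at the root
  q^s.\<close>

lemma sum_wt_powers:
  assumes "s \<in> {1..<n}" "t \<in> {1..<n}"
  shows "(q ^ s - 1) * (\<Sum>i\<in>{1..<n}. wt (q ^ s) (q ^ t) i) = (if s = t then of_nat n / q ^ s else 0)"
proof (cases "s = t")
  case True
  have z: "poly cyclo (q ^ s) = 0"
    using assms by (auto simp: cyclo_def poly_prod)
  have "pderiv ([:-1, 1:] * cyclo) = pderiv (monom 1 n - 1)"
    by (simp only: cyclo_times_X_minus_1)
  then have "[:-1, 1:] * pderiv cyclo + cyclo * pderiv [:-1, 1:] = monom (of_nat n) (n - 1)"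
    by (simp only: pderiv_mult pderiv_diff pderiv_monom pderiv_1 mult_1_right diff_0_right)
  then have "poly ([:-1, 1:] * pderiv cyclo + cyclo * pderiv [:-1, 1:]) (q ^ s)
      = poly (monom (of_nat n) (n - 1)) (q ^ s)"
    by simp
  then have "(q ^ s - 1) * poly (pderiv cyclo) (q ^ s) = of_nat n * (q ^ s) ^ (n - 1)"
    using z by (simp add: poly_monom left_diff_distrib)
  moreover have "(q ^ s) ^ (n - 1) = 1 / q ^ s"
    using power_power_n[of s] n_ge_2 q_nonzero power_minus_mult[of n "q ^ s"]
    by (simp add: nonzero_eq_divide_eq)
  ultimately show ?thesis using True sum_wt_diagonal[of "q ^ s"] by simp
next
  case False
  have "poly cyclo (q ^ s) = 0" "poly cyclo (q ^ t) = 0"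
    using assms by (auto simp: cyclo_def poly_prod)
  then have "(q ^ s - q ^ t) * (\<Sum>i\<in>{1..<n}. wt (q ^ s) (q ^ t) i) = 0"
    by (simp only: sum_wt_telescope diff_0_right)
  then show ?thesis using False assms power_eq_iff by auto
qed

section \<open>The q-difference equation in the second variable\<close>

definition wsum :: "complex \<Rightarrow> complex \<Rightarrow> complex" where
  "wsum A B = (\<Sum>i\<in>{1..<n}. wt A B i / (1 - q ^ i))"

text \<open>Since q^n = 1, the factor q B - 1 is the missing term for j = n. Taking q out of each
  factor then moves the index range down by one, and q^i completes the collected power q^(n - i) to
  1.\<close>

lemma wt_shift:
  assumes "i \<in> {1..<n}"
  shows "q ^ i * (q * B - 1) * wt A (q * B) i = (B - q ^ i) * wt A B i"
proof -
  have ins: "{i<..n} = insert n {i<..<n}" "{i..<n} = insert i {i<..<n}" using assms by auto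
  have "(q * B - 1) * (\<Prod>j\<in>{i<..<n}. q * B - q ^ j) = (\<Prod>j\<in>{i<..n}. q * B - q ^ j)"
    unfolding ins using power_n by simp
  also have "\<dots> = (\<Prod>j\<in>{i..<n}. q * B - q ^ Suc j)"
    by (rule prod.reindex_bij_witness[of _ Suc "\<lambda>j. j - 1"]) auto
  also have "\<dots> = (\<Prod>j\<in>{i..<n}. q * (B - q ^ j))"
    by (simp add: algebra_simps)
  also have "\<dots> = q ^ (n - i) * ((B - q ^ i) * (\<Prod>j\<in>{i<..<n}. B - q ^ j))"
    unfolding ins(2)[symmetric] prod.distrib by (subst (2) ins(2)) simp
  finally have "(q * B - 1) * (\<Prod>j\<in>{i<..<n}. q * B - q ^ j)
      = q ^ (n - i) * ((B - q ^ i) * (\<Prod>j\<in>{i<..<n}. B - q ^ j))" .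
  then have "q ^ i * ((q * B - 1) * (\<Prod>j\<in>{i<..<n}. q * B - q ^ j))
      = q ^ n * ((B - q ^ i) * (\<Prod>j\<in>{i<..<n}. B - q ^ j))"
    using assms by (simp add: power_add[symmetric] flip: mult.assoc)
  then have "(\<Prod>j\<in>{1..<i}. A - q ^ j) * (q ^ i * ((q * B - 1) * (\<Prod>j\<in>{i<..<n}. q * B - q ^ j)))
      = (\<Prod>j\<in>{1..<i}. A - q ^ j) * ((B - q ^ i) * (\<Prod>j\<in>{i<..<n}. B - q ^ j))"
    by (simp only: power_n mult_1_left)
  then show ?thesis unfolding wt_def by (simp only: mult_ac)
qed

text \<open>Substitute q^i = 1 - (1 - q^i) and B - q^i = (B - 1) + (1 - q^i) in
  \<open>wt_shift\<close>: the parts containing 1 - q^i lose their denominator and become the plain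
  sums of \<open>wt\<close>, which are known at powers of \<open>q\<close>.\<close>

lemma wsum_shift:
  "(q * B - 1) * wsum A (q * B) - (B - 1) * wsum A B
     = (\<Sum>i\<in>{1..<n}. wt A B i) + (q * B - 1) * (\<Sum>i\<in>{1..<n}. wt A (q * B) i)"
proof -
  have "(q * B - 1) * (wt A (q * B) i / (1 - q ^ i)) - (B - 1) * (wt A B i / (1 - q ^ i))
      = wt A B i + (q * B - 1) * wt A (q * B) i" if i: "i \<in> {1..<n}" for i
  proof -
    have "1 - q ^ i \<noteq> 0" using power_neq_1[of i] i by auto
    moreover have "(q * B - 1) * wt A (q * B) i - (B - 1) * wt A B i
        = (wt A B i + (q * B - 1) * wt A (q * B) i) * (1 - q ^ i)"
      using wt_shift[OF i, of B A] by (simp add: algebra_simps)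
    ultimately show ?thesis
      by (simp add: nonzero_divide_eq_eq flip: diff_divide_distrib)
  qed
  then show ?thesis
    unfolding wsum_def sum_distrib_left sum.distrib[symmetric] sum_subtractf[symmetric]
    by (intro sum.cong) auto
qed

text \<open>The recurrence in \<open>t\<close> is run downwards from \<open>t = n\<close>, where the factor \<open>q ^ t - 1\<close> vanishes.\<close>

lemma wsum_powers:
  assumes s: "s \<in> {1..<n}" and t: "1 \<le> t" "t \<le> n"
  shows "(q ^ t - 1) * wsum (q ^ s) (q ^ t) =
    (if s < t then 0 else if s = t then of_nat n / (q ^ s * (1 - q ^ s)) else of_nat n / (1 - q ^ s))"
  using t(2,1)
proof (induction rule: inc_induct)
  case base
  then show ?case using s power_n by simp
next
  case (step t)
  have s1: "q ^ s \<noteq> 1" using power_neq_1[of s] s by auto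
  let ?U = "\<lambda>t. \<Sum>i\<in>{1..<n}. wt (q ^ s) (q ^ t) i"
  have U: "?U t = (if s = t then of_nat n / (q ^ s * (q ^ s - 1)) else 0)"
  proof -
    have "(q ^ s - 1) * ?U t = (if s = t then of_nat n / q ^ s else 0)"
      using sum_wt_powers[OF s, of t] step by simp
    then have "?U t = (if s = t then of_nat n / q ^ s else 0) / (q ^ s - 1)"
      using s1 by (simp add: nonzero_eq_divide_eq mult.commute)
    then show ?thesis by simp
  qed
  \<comment> \<open>At \<open>Suc t = n\<close> the factor in front is 0. Otherwise
    \<open>sum_wt_powers\<close> applies: its factor q^s - 1 is the one needed if
    \<open>s = Suc t\<close>, and the sum is 0 if not.\<close>
  have U': "(q ^ Suc t - 1) * ?U (Suc t) = (if s = Suc t then of_nat n / q ^ s else 0)"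
  proof (cases "Suc t = n")
    case True
    then show ?thesis using power_n s by (simp only:) simp
  next
    case False
    then have "Suc t \<in> {1..<n}" using step by auto
    then show ?thesis using sum_wt_powers[OF s, of "Suc t"] power_neq_1[of "Suc t"] s1
      by (auto split: if_splits)
  qed
  have "(q ^ t - 1) * wsum (q ^ s) (q ^ t)
      = (q ^ Suc t - 1) * wsum (q ^ s) (q ^ Suc t) - ?U t - (q ^ Suc t - 1) * ?U (Suc t)"
    using wsum_shift[of "q ^ t" "q ^ s"] by (simp add: algebra_simps)
  also have "\<dots> = (if s < Suc t then 0 else if s = Suc t then of_nat n / (q ^ s * (1 - q ^ s)) else of_nat n / (1 - q ^ s))
      - (if s = t then of_nat n / (q ^ s * (q ^ s - 1)) else 0) - (if s = Suc t then of_nat n / q ^ s else 0)"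
    using step.IH U U' by simp
  \<comment> \<open>The value changes only twice on the way down: at \<open>t = s\<close> it jumps
    from 0, and at \<open>Suc t = s\<close> subtracting n / q^s cancels the factor q^s in the
    denominator.\<close>
  also have "\<dots> = (if s < t then 0 else if s = t then of_nat n / (q ^ s * (1 - q ^ s)) else of_nat n / (1 - q ^ s))"
    using s1 q_nonzero by (auto simp: field_simps)
  finally show ?case .
qed

lemma cyc_sum_generating_function_eq_wsum:
  "(\<Sum>a<n - 1. \<Sum>b<n - 1. cyc_sum n q (replicate a 1 @ [2] @ replicate b 1) * u ^ a * v ^ b)
     = wsum (1 + u) (1 + v) / of_nat n"
proof -
  have fac: "1 + u * (1 / (1 - q ^ j)) = (1 + u - q ^ j) / (1 - q ^ j)" if "j \<in> {1..<n}" for j u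
    using power_neq_1[of j] that by (auto simp: field_simps)
  have "(1 / (1 - q ^ i)) ^ 2 * (\<Prod>j\<in>{1..<i}. 1 + u * (1 / (1 - q ^ j)))
          * (\<Prod>j\<in>{i<..<n}. 1 + v * (1 / (1 - q ^ j)))
      = wt (1 + u) (1 + v) i / (1 - q ^ i) / of_nat n" if i: "i \<in> {1..<n}" for i
  proof -
    have p1: "(\<Prod>j\<in>{1..<i}. 1 + u * (1 / (1 - q ^ j)))
        = (\<Prod>j\<in>{1..<i}. 1 + u - q ^ j) / (\<Prod>j\<in>{1..<i}. 1 - q ^ j)"
      unfolding prod_dividef[symmetric] using i by (intro prod.cong fac) auto
    have p2: "(\<Prod>j\<in>{i<..<n}. 1 + v * (1 / (1 - q ^ j)))
        = (\<Prod>j\<in>{i<..<n}. 1 + v - q ^ j) / (\<Prod>j\<in>{i<..<n}. 1 - q ^ j)"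
      unfolding prod_dividef[symmetric] using i by (intro prod.cong fac) auto
    \<comment> \<open>The two denominators and one factor 1 - q^i multiply to n; the other factor 1
      - q^i remains from the square.\<close>
    have "{1..<n} = insert i ({1..<i} \<union> {i<..<n})" "{1..<i} \<inter> {i<..<n} = {}" using i by auto
    then have "of_nat n = (1 - q ^ i) * ((\<Prod>j\<in>{1..<i}. 1 - q ^ j) * (\<Prod>j\<in>{i<..<n}. 1 - q ^ j))"
      unfolding prod_one_minus_powers[symmetric] by (simp add: prod.union_disjoint)
    then show ?thesis unfolding p1 p2 wt_def by (simp add: power2_eq_square)
  qed
  then show ?thesis
    unfolding cyc_sum_generating_function[OF n_ge_2] wsum_def sum_divide_distrib
    by (intro sum.cong) auto
qed

text \<open>For distinct exponents exactly one of the two orders contributes; on the diagonal the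
  same value occurs twice.\<close>

lemma symmetrized_wsum:
  assumes "s \<in> {1..<n}" "t \<in> {1..<n}"
  shows "wsum (q ^ s) (q ^ t) + wsum (q ^ t) (q ^ s) =
    (if s = t then - 2 * of_nat n / (q ^ s * (q ^ s - 1) ^ 2)
     else - of_nat n / ((q ^ s - 1) * (q ^ t - 1)))"
proof -
  have K: "wsum (q ^ s) (q ^ t) = (if s < t then 0 else if s = t then - of_nat n / (q ^ s * (q ^ s - 1) ^ 2)
      else - of_nat n / ((q ^ s - 1) * (q ^ t - 1)))"
    if "s \<in> {1..<n}" "t \<in> {1..<n}" for s t
  proof -
    have "q ^ s \<noteq> 1" "q ^ t \<noteq> 1" using that power_neq_1[of s] power_neq_1[of t] by auto
    then have "wsum (q ^ s) (q ^ t) = (if s < t then 0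
        else if s = t then of_nat n / (q ^ s * (1 - q ^ s)) else of_nat n / (1 - q ^ s)) / (q ^ t - 1)"
      using wsum_powers[of s t] that by (simp add: nonzero_eq_divide_eq mult.commute)
    moreover have "1 - q ^ s = - (q ^ s - 1)" by simp
    ultimately show ?thesis
      by (simp only: mult_minus_right divide_minus_right) (simp add: power2_eq_square mult_ac)
  qed
  show ?thesis using K[OF assms] K[OF assms(2,1)] by (auto simp: mult.commute)
qed

end

subsection \<open>The generating function of the right-hand side\<close>

definition rhs_coeff :: "nat \<Rightarrow> nat \<Rightarrow> complex" where
  "rhs_coeff n m = - (fact m * (of_nat n - 2 * of_nat m - 3) / fact (m + 2)) * of_nat ((n - 1) choose m)"

text \<open>This form lets the binomial theorem sum the coefficients. By absorption both binomials
  are multiples of \<open>(n - 1) choose m\<close>, and with k = n - 1 the numerator splits as n -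
  2m - 3 = (k - m) - (m + 2).\<close>

lemma rhs_coeff_eq_binomial_diff:
  assumes "n > 0"
  shows "rhs_coeff n m = (of_nat (n choose (m + 1)) - of_nat (n choose (m + 2))) / of_nat n"
proof -
  obtain k where n: "n = Suc k" using assms by (cases n) auto
  define C where "C = (of_nat (k choose m) :: complex)"
  have m1: "of_nat m + 1 \<noteq> (0 :: complex)" and m2: "of_nat m + 2 \<noteq> (0 :: complex)"
    using of_nat_neq_0[of m, where 'a = complex] of_nat_neq_0[of "Suc m", where 'a = complex]
    by (simp_all add: add.commute)
  have "of_nat (Suc m * (n choose Suc m)) = (of_nat (n * (k choose m)) :: complex)"
    by (simp only: binomial_absorption n diff_Suc_1)
  then have 1: "of_nat (n choose (m + 1)) = of_nat n * C / (of_nat m + 1)"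
    using m1 by (simp add: C_def nonzero_eq_divide_eq algebra_simps)
  have "of_nat (Suc (Suc m) * (n choose Suc (Suc m))) = (of_nat (n * (k choose Suc m)) :: complex)"
    by (simp only: binomial_absorption n diff_Suc_1)
  then have "(of_nat m + 2) * of_nat (n choose (m + 2)) = of_nat n * (of_nat (k choose Suc m) :: complex)"
    by (simp add: algebra_simps)
  moreover have "(of_nat m + 1) * of_nat (k choose Suc m) = (of_nat k - of_nat m) * C"
  \<comment> \<open>For \<open>m > k\<close> natural subtraction truncates \<open>k - m\<close>, but
    then both binomials are 0.\<close>
  proof (cases "m \<le> k")
    case True
    have "of_nat (Suc m * (k choose Suc m)) = (of_nat ((k - m) * (k choose m)) :: complex)"
      by (simp only: binomial_absorb_comp binomial_absorption)
    then show ?thesis using True by (simp add: C_def of_nat_diff algebra_simps)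
  qed (simp add: C_def binomial_eq_0)
  ultimately have 2: "of_nat (n choose (m + 2)) = of_nat n * ((of_nat k - of_nat m) * C) / ((of_nat m + 1) * (of_nat m + 2))"
    using m1 m2 by (simp add: nonzero_eq_divide_eq mult_ac)
  have f: "fact (m + 2) = (of_nat m + 2) * (of_nat m + 1) * (fact m :: complex)"
    by (simp add: algebra_simps)
  have "rhs_coeff n m = (- (of_nat n - 2 * of_nat m - 3) * C) / ((of_nat m + 1) * (of_nat m + 2))"
  proof -
    have "- (F * D / (a * b * F)) * E = (- D * E) / (b * a)" if "F \<noteq> 0" for F D E a b :: complex
      using that by (simp add: mult.commute)
    then show ?thesis unfolding rhs_coeff_def f C_def n diff_Suc_1 using fact_nonzero by blast
  qed
  also have "- (of_nat n - 2 * of_nat m - 3) * C = (of_nat m + 2) * C - (of_nat k - of_nat m) * C"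
    using n by (simp add: algebra_simps)
  also have "\<dots> / ((of_nat m + 1) * (of_nat m + 2))
      = C / (of_nat m + 1) - (of_nat k - of_nat m) * C / ((of_nat m + 1) * (of_nat m + 2))"
    unfolding diff_divide_distrib using m2 by simp
  also have "\<dots> = (of_nat (n choose (m + 1)) - of_nat (n choose (m + 2))) / of_nat n"
    unfolding 1 2 diff_divide_distrib using assms by simp
  finally show ?thesis .
qed

text \<open>This is H. Its constant coefficient completes the closed form but cancels in H(u) - H(v)
  and in H'.\<close>

definition rhs_poly :: "nat \<Rightarrow> complex poly" where
  "rhs_poly n = (\<Sum>m<n. monom (rhs_coeff n m) m)"

lemma rhs_poly_closed_form:
  assumes "n > 0"
  shows "smult (of_nat n) ([:0, 1:] ^ 2 * rhs_poly n) = smult (of_nat n) [:0, 1:] - [:1, -1:] * ([:1, 1:] ^ n - 1)"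
proof (subst poly_eq_poly_eq_iff[symmetric], rule ext)
  fix u :: complex
  have bin: "(1 + u) ^ n = (\<Sum>k<Suc n. of_nat (n choose k) * u ^ k)"
    using binomial_ring[of u 1 n] by (simp add: lessThan_Suc_atMost add.commute)
  have b1: "(\<Sum>m<n. of_nat (n choose (m + 1)) * u ^ (m + 1)) = (1 + u) ^ n - 1"
    unfolding bin by (subst sum.lessThan_Suc_shift) simp
  \<comment> \<open>The added term for k = n + 1 is 0; it makes the sum long enough to strip two
    initial terms and keep \<open>n\<close>.\<close>
  have "(1 + u) ^ n = (\<Sum>k<Suc (Suc n). of_nat (n choose k) * u ^ k)"
    unfolding bin by simp
  then have b2: "(\<Sum>m<n. of_nat (n choose (m + 2)) * u ^ (m + 2)) = (1 + u) ^ n - 1 - of_nat n * u"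
    by (simp only: sum.lessThan_Suc_shift) simp
  have "of_nat n * (u ^ 2 * poly (rhs_poly n) u)
      = (\<Sum>m<n. u * (of_nat (n choose (m + 1)) * u ^ (m + 1)) - of_nat (n choose (m + 2)) * u ^ (m + 2))"
    unfolding rhs_poly_def poly_sum poly_monom sum_distrib_left using assms
    by (intro sum.cong) (simp_all add: rhs_coeff_eq_binomial_diff field_simps power2_eq_square)
  also have "\<dots> = u * ((1 + u) ^ n - 1) - ((1 + u) ^ n - 1 - of_nat n * u)"
    unfolding sum_subtractf sum_distrib_left[symmetric] b1 b2 ..
  finally show "poly (smult (of_nat n) ([:0, 1:] ^ 2 * rhs_poly n)) u
      = poly (smult (of_nat n) [:0, 1:] - [:1, -1:] * ([:1, 1:] ^ n - 1)) u"
    by (simp add: algebra_simps)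
qed

lemma rhs_poly_at_root:
  assumes "n > 0" "(1 + u) ^ n = 1" "u \<noteq> 0"
  shows "poly (rhs_poly n) u = 1 / u"
proof -
  have "poly (smult (of_nat n) ([:0, 1:] ^ 2 * rhs_poly n)) u = of_nat n * u"
    unfolding rhs_poly_closed_form[OF assms(1)] using assms by (simp add: mult.commute)
  then show ?thesis using assms by (simp add: field_simps power2_eq_square)
qed

text \<open>Differentiate the closed form: where (1 + u)^n = 1, the right-hand side becomes n - n (1
  - u) / (1 + u), and the known value H(u) = 1 / u isolates H'(u).\<close>

lemma pderiv_rhs_poly_at_root:
  assumes "n > 0" "(1 + u) ^ n = 1" "u \<noteq> 0"
  shows "poly (pderiv (rhs_poly n)) u = - 2 / ((1 + u) * u ^ 2)"
proof -
  have u1: "1 + u \<noteq> 0" using assms by (auto simp: power_0_left)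
  have p: "(1 + u) ^ (n - 1) = 1 / (1 + u)"
    using assms u1 power_minus_mult[of n "1 + u"] by (simp add: nonzero_eq_divide_eq)
  have "pderiv (smult (of_nat n) ([:0, 1:] ^ 2 * rhs_poly n))
      = smult (of_nat n) (pderiv [:0, 1:])
        - ([:1, -1:] * pderiv ([:1, 1:] ^ n) + ([:1, 1:] ^ n - 1) * pderiv [:1, -1:])"
    unfolding rhs_poly_closed_form[OF assms(1)]
    by (simp only: pderiv_diff pderiv_mult pderiv_smult pderiv_1 diff_0_right)
  then have "poly (pderiv (smult (of_nat n) ([:0, 1:] ^ 2 * rhs_poly n))) u
      = of_nat n - (1 - u) * (of_nat n * (1 + u) ^ (n - 1))"
    using assms(2) by (simp add: pderiv_power pderiv_pCons) (simp add: algebra_simps)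
  then have "of_nat n * (2 * u * poly (rhs_poly n) u + u ^ 2 * poly (pderiv (rhs_poly n)) u)
      = of_nat n * (1 - (1 - u) / (1 + u))"
    unfolding p by (simp add: pderiv_mult pderiv_smult pderiv_power pderiv_pCons power2_eq_square algebra_simps)
  then have *: "2 * u * poly (rhs_poly n) u + u ^ 2 * poly (pderiv (rhs_poly n)) u = 1 - (1 - u) / (1 + u)"
    using assms(1) by simp
  have "u ^ 2 * poly (pderiv (rhs_poly n)) u = - 2 / (1 + u)"
  proof -
    have 1: "1 - (1 - u) / (1 + u) = 2 + - 2 / (1 + u)" using u1 by (simp add: field_simps)
    have 2: "2 * u * poly (rhs_poly n) u = 2"
      unfolding rhs_poly_at_root[OF assms] using assms(3) by simp
    show ?thesis using * unfolding 1 2 by (simp only: add_left_cancel)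
  qed
  then have "poly (pderiv (rhs_poly n)) u = - 2 / (1 + u) / u ^ 2"
    using assms(3) by (subst nonzero_eq_divide_eq) (simp_all add: mult.commute)
  then show ?thesis by simp
qed

lemma rhs_coeff_generating_function:
  assumes "n \<ge> 2"
  shows "(\<Sum>a<n - 1. \<Sum>b<n - 1. rhs_coeff n (a + b + 1) * u ^ a * v ^ b)
    = (\<Sum>k<n - 1. rhs_coeff n (Suc k) * (\<Sum>a\<le>k. u ^ a * v ^ (k - a)))"
proof -
  have z: "rhs_coeff n m = 0" if "m \<ge> n" for m
    using that assms by (simp add: rhs_coeff_def binomial_eq_0)
  have "(\<Sum>a<n - 1. \<Sum>b<n - 1. rhs_coeff n (a + b + 1) * u ^ a * v ^ b)
      = (\<Sum>(a, b)\<in>{..<n - 1} \<times> {..<n - 1}. rhs_coeff n (a + b + 1) * u ^ a * v ^ b)"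
    by (simp add: sum.cartesian_product)
  \<comment> \<open>Terms with a + b >= n - 1 drop out because
    \<open>(n - 1) choose (a + b + 1)\<close> is 0; the remaining triangle is summed by total
    degree.\<close>
  also have "\<dots> = (\<Sum>(a, b)\<in>{(a, b). a + b < n - 1}. rhs_coeff n (a + b + 1) * u ^ a * v ^ b)"
    by (rule sum.mono_neutral_right) (auto intro!: z)
  also have "\<dots> = (\<Sum>k<n - 1. \<Sum>a\<le>k. rhs_coeff n (a + (k - a) + 1) * u ^ a * v ^ (k - a))"
    by (rule sum.triangle_reindex)
  also have "\<dots> = (\<Sum>k<n - 1. rhs_coeff n (Suc k) * (\<Sum>a\<le>k. u ^ a * v ^ (k - a)))"
    by (auto simp: sum_distrib_left mult.assoc intro!: sum.cong)
  finally show ?thesis .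
qed

lemma poly_rhs_poly_Suc:
  assumes "n > 0"
  shows "poly (rhs_poly n) u = rhs_coeff n 0 + (\<Sum>k<n - 1. rhs_coeff n (Suc k) * u ^ Suc k)"
proof -
  obtain k where n: "n = Suc k" using assms by (cases n) auto
  show ?thesis
    unfolding rhs_poly_def poly_sum poly_monom n by (subst sum.lessThan_Suc_shift) simp
qed

text \<open>Multiplication by u - v turns each homogeneous inner sum into u^(k+1) - v^(k+1), so the
  double sum is the difference quotient of H.\<close>

lemma rhs_coeff_generating_function_off_diagonal:
  assumes "n \<ge> 2"
  shows "(u - v) * (\<Sum>a<n - 1. \<Sum>b<n - 1. rhs_coeff n (a + b + 1) * u ^ a * v ^ b)
    = poly (rhs_poly n) u - poly (rhs_poly n) v"
proof -
  have "(u - v) * (\<Sum>a\<le>k. u ^ a * v ^ (k - a)) = u ^ Suc k - v ^ Suc k" for k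
    using diff_power_eq_sum[of u k v] by (simp only: lessThan_Suc_atMost)
  then have "(u - v) * (rhs_coeff n (Suc k) * (\<Sum>a\<le>k. u ^ a * v ^ (k - a)))
      = rhs_coeff n (Suc k) * u ^ Suc k - rhs_coeff n (Suc k) * v ^ Suc k" for k
    by (simp only: mult.left_commute[of "u - v"] right_diff_distrib)
  then show ?thesis
    using assms unfolding rhs_coeff_generating_function[OF assms] sum_distrib_left[of "u - v"]
    by (simp add: poly_rhs_poly_Suc sum_subtractf del: power_Suc)
qed

text \<open>For v = u each inner sum becomes (k + 1) u^k, which gives the coefficients of
  H'.\<close>

lemma rhs_coeff_generating_function_diagonal:
  assumes "n \<ge> 2"
  shows "(\<Sum>a<n - 1. \<Sum>b<n - 1. rhs_coeff n (a + b + 1) * u ^ a * u ^ b) = poly (pderiv (rhs_poly n)) u"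
proof -
  obtain k where n: "n = Suc k" using assms by (cases n) auto
  have "poly (pderiv (rhs_poly n)) u = (\<Sum>m<n. of_nat m * rhs_coeff n m * u ^ (m - 1))"
    by (simp add: rhs_poly_def higher_pderiv_sum[of 1, simplified] pderiv_monom poly_sum poly_monom)
  also have "\<dots> = (\<Sum>m<n - 1. of_nat (Suc m) * rhs_coeff n (Suc m) * u ^ m)"
    unfolding n by (subst sum.lessThan_Suc_shift) simp
  also have "\<dots> = (\<Sum>k<n - 1. rhs_coeff n (Suc k) * (\<Sum>a\<le>k. u ^ a * u ^ (k - a)))"
    by (auto intro!: sum.cong simp flip: power_add)
  finally show ?thesis unfolding rhs_coeff_generating_function[OF assms] ..
qed

subsection \<open>Comparing coefficients on a grid\<close>

lemma polynomial_coeffs_zero: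
  fixes c :: "nat \<Rightarrow> 'a::{comm_ring_1, ring_no_zero_divisors}"
  assumes "card S \<ge> N" "\<And>z. z \<in> S \<Longrightarrow> (\<Sum>a<N. c a * z ^ a) = 0" "a < N"
  shows "c a = 0"
proof -
  let ?p = "\<Sum>a<N. monom (c a) a"
  have "degree ?p < N"
    using assms(3) by (intro degree_sum_less) (auto intro: le_less_trans[OF degree_monom_le])
  then have "?p = 0"
    using assms by (intro poly_eqI_degree[where A = S]) (auto simp: poly_sum poly_monom)
  moreover have "coeff ?p a = c a"
    using assms(3) by (simp add: coeff_sum)
  ultimately show ?thesis by simp
qed

text \<open>For fixed \<open>v\<close> the sum is a polynomial in \<open>u\<close> vanishing on
  \<open>S\<close>, so its coefficients are 0; these are polynomials in \<open>v\<close> vanishing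
  on \<open>S\<close>.\<close>

lemma bivariate_polynomial_coeffs_zero:
  fixes c :: "nat \<Rightarrow> nat \<Rightarrow> 'a::{comm_ring_1, ring_no_zero_divisors}"
  assumes "card S \<ge> N"
    and "\<And>u v. u \<in> S \<Longrightarrow> v \<in> S \<Longrightarrow> (\<Sum>a<N. \<Sum>b<N. c a b * u ^ a * v ^ b) = 0"
    and "a < N" "b < N"
  shows "c a b = 0"
proof (rule polynomial_coeffs_zero[OF assms(1) _ assms(4)])
  fix v assume v: "v \<in> S"
  show "(\<Sum>b<N. c a b * v ^ b) = 0"
  proof (rule polynomial_coeffs_zero[OF assms(1) _ assms(3)])
    fix u assume u: "u \<in> S"
    show "(\<Sum>a<N. (\<Sum>b<N. c a b * v ^ b) * u ^ a) = 0"
      using assms(2)[OF u v] unfolding sum_distrib_right by (simp only: mult_ac)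
  qed
qed

lemma (in primitive_root_of_unity) symmetrized_cyc_sum:
  assumes "a < n - 1" "b < n - 1"
  shows "cyc_sum n q (replicate a 1 @ [2] @ replicate b 1)
       + cyc_sum n q (replicate b 1 @ [2] @ replicate a 1) = rhs_coeff n (a + b + 1)"
proof -
  let ?Z = "\<lambda>a b. cyc_sum n q (replicate a 1 @ [2] @ replicate b 1)"
  let ?S = "(\<lambda>s. q ^ s - 1) ` {1..<n}"
  have "?Z a b + ?Z b a - rhs_coeff n (a + b + 1) = 0"
  proof (rule bivariate_polynomial_coeffs_zero[where N = "n - 1" and S = ?S, OF _ _ assms])
    have "inj_on (\<lambda>s. q ^ s - 1) {1..<n}"
      by (auto simp: inj_on_def power_eq_iff)
    then show "n - 1 \<le> card ?S" by (simp add: card_image)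
    fix u v assume "u \<in> ?S" "v \<in> ?S"
    then obtain s t where s: "s \<in> {1..<n}" "u = q ^ s - 1" and t: "t \<in> {1..<n}" "v = q ^ t - 1"
      by blast
    have u: "(1 + u) ^ n = 1" "u \<noteq> 0" and v: "(1 + v) ^ n = 1" "v \<noteq> 0"
      using s t power_power_n power_neq_1[of s] power_neq_1[of t] by auto
    have n0: "n > 0" using n_ge_2 by simp
    \<comment> \<open>Reversing the argument list amounts to exchanging \<open>u\<close> and
      \<open>v\<close>.\<close>
    have swap: "(\<Sum>a<n - 1. \<Sum>b<n - 1. ?Z b a * u ^ a * v ^ b) = (\<Sum>a<n - 1. \<Sum>b<n - 1. ?Z a b * v ^ a * u ^ b)"
      by (subst sum.swap) (simp only: mult_ac)
    have "(\<Sum>a<n - 1. \<Sum>b<n - 1. (?Z a b + ?Z b a - rhs_coeff n (a + b + 1)) * u ^ a * v ^ b)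
       = (\<Sum>a<n - 1. \<Sum>b<n - 1. ?Z a b * u ^ a * v ^ b) + (\<Sum>a<n - 1. \<Sum>b<n - 1. ?Z a b * v ^ a * u ^ b)
         - (\<Sum>a<n - 1. \<Sum>b<n - 1. rhs_coeff n (a + b + 1) * u ^ a * v ^ b)"
      by (simp only: distrib_right left_diff_distrib sum.distrib sum_subtractf swap)
    also have "\<dots> = (wsum (q ^ s) (q ^ t) + wsum (q ^ t) (q ^ s)) / of_nat n
         - (\<Sum>a<n - 1. \<Sum>b<n - 1. rhs_coeff n (a + b + 1) * u ^ a * v ^ b)"
      unfolding cyc_sum_generating_function_eq_wsum using s t by (simp add: add_divide_distrib)
    also have "\<dots> = 0"
    proof (cases "s = t")
      case True
      have "(\<Sum>a<n - 1. \<Sum>b<n - 1. rhs_coeff n (a + b + 1) * u ^ a * v ^ b) = - 2 / ((1 + u) * u ^ 2)"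
        using rhs_coeff_generating_function_diagonal[OF n_ge_2, of u] pderiv_rhs_poly_at_root[OF n0 u] s t True
        by simp
      then show ?thesis using symmetrized_wsum[OF s(1) t(1)] True s n0 by simp
    next
      case False
      then have "u - v \<noteq> 0" using s t power_eq_iff by auto
      moreover have "(u - v) * (\<Sum>a<n - 1. \<Sum>b<n - 1. rhs_coeff n (a + b + 1) * u ^ a * v ^ b) = 1 / u - 1 / v"
        using rhs_coeff_generating_function_off_diagonal[OF n_ge_2, of u v] rhs_poly_at_root[OF n0 u]
          rhs_poly_at_root[OF n0 v] by simp
      \<comment> \<open>H takes the value 1 / u at the grid points, so its difference quotient there
        is -1 / (u v), the off-diagonal value of \<open>symmetrized_wsum\<close> divided by
        n.\<close>
      moreover have "1 / u - 1 / v = (u - v) * (- 1 / (u * v))"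
        using u v by (simp add: field_simps)
      ultimately have "(\<Sum>a<n - 1. \<Sum>b<n - 1. rhs_coeff n (a + b + 1) * u ^ a * v ^ b) = - 1 / (u * v)"
        by (simp only: mult_cancel_left simp_thms)
      then show ?thesis using symmetrized_wsum[OF s(1) t(1)] False s t n0 by simp
    qed
    finally show "(\<Sum>a<n - 1. \<Sum>b<n - 1. (?Z a b + ?Z b a - rhs_coeff n (a + b + 1)) * u ^ a * v ^ b) = 0" .
  qed
  then show ?thesis by simp
qed

section \<open>Empty sums and the concrete root of unity\<close>

lemma index_tuples_empty:
  assumes "n \<ge> 1" "m \<ge> n"
  shows "index_tuples n m = {}"
proof -
  have False if "is \<in> index_tuples n m" for "is"
  proof -
    have "card (set is) = m" "set is \<subseteq> {1..n - 1}"
      using that by (auto simp: index_tuples_def strict_sorted_iff distinct_card)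
    with card_mono[of "{1..n - 1}" "set is"] assms show False by simp
  qed
  then show ?thesis by blast
qed

lemma primitive_root_of_unity_root_of_unity:
  assumes "n \<ge> 2"
  shows "primitive_root_of_unity n (root_of_unity n)"
proof -
  have pow: "root_of_unity n ^ k = cis (2 * pi * real k / real n)" for k
    by (simp add: root_of_unity_def cis_conv_exp exp_of_nat_mult[symmetric] mult_ac)
  show ?thesis
  proof
    show "root_of_unity n ^ n = 1" unfolding pow using assms by simp
    show "inj_on (\<lambda>k. root_of_unity n ^ k) {..<n}"
      unfolding pow using bij_betw_roots_unity[of n] assms by (auto simp: bij_betw_def)
  qed (fact assms)
qed

theorem theorem1:
  fixes a b m n :: nat
  assumes "m = a + b + 1" and "m \<ge> 2" and "n \<ge> 2"
  shows "cyc_sum n (root_of_unity n) (replicate a 1 @ [2] @ replicate b 1)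
       + cyc_sum n (root_of_unity n) (replicate b 1 @ [2] @ replicate a 1)
       = - (fact m * (of_nat n - 2 * of_nat m - 3) / fact (m + 2)) * of_nat ((n - 1) choose m)"
proof (cases "a < n - 1 \<and> b < n - 1")
  case True
  interpret primitive_root_of_unity n "root_of_unity n"
    by (rule primitive_root_of_unity_root_of_unity) fact
  show ?thesis using symmetrized_cyc_sum[of a b] True assms(1) by (simp add: rhs_coeff_def)
next
  case False
  \<comment> \<open>Outside the range of the coefficient comparison there are more positions than
    available indices: both sums are empty and the binomial is 0.\<close>
  then have "m \<ge> n" using assms by auto
  then show ?thesis
    using assms index_tuples_empty[of n m] by (simp add: cyc_sum_def binomial_eq_0 add.commute)
qed

end
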